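(* Let $N\ge 7$ be an odd integer. The number of spanning trees of $G_N^{(2)}$ is \[ t(G_N^{(2)})=\frac{|\mathcal P_N^{(2)}-2|^2}{N^2}. \]
   Context: For odd $N$, the graph $G_N^{(2)}$ has vertex set $\mathbb Z/N\mathbb Z$; two distinct vertices $x,y$ are adjacent iff their circular distance $\min\{|x-y|,N-|x-y|\}$ (with representatives in $\{0,\dots,N-1\}$) is at least $3$. $t(G)$ denotes the number of spanning trees of $G$. Set $\tau:=\frac{-1+i\sqrt{4N-25}}{2}$ and let $\rho\in\mathbb C$ be the solution of $\rho+\rho^{-1}=\tau$ with $|\rho|<1$; then $\mathcal P_k^{(2)}:=\rho^k+\rho^{-k}$ for $k\ge0$. *)

theory Defs
  imports Complex_Main
begin

text \<open>
  A finite simple graph is given by a vertex set \<open>V\<close> and a set \<open>E\<close> of two-element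
  subsets of \<open>V\<close>.  The trees of the AFP entry Graph_Theory do not fit here: there a forest
  is a digraph without \<^emph>\<open>directed\<close> cycles, and two opposite arcs already form a cycle.
\<close>

definition walk :: "'a set \<Rightarrow> 'a set set \<Rightarrow> 'a list \<Rightarrow> bool" where
  "walk V E p \<longleftrightarrow> p \<noteq> [] \<and> set p \<subseteq> V \<and> successively (\<lambda>x y. {x, y} \<in> E) p"

definition connected_graph :: "'a set \<Rightarrow> 'a set set \<Rightarrow> bool" where
  "connected_graph V E \<longleftrightarrow>
     V \<noteq> {} \<and> (\<forall>u\<in>V. \<forall>v\<in>V. \<exists>p. walk V E p \<and> hd p = u \<and> last p = v)"

text \<open>
  The list of a cycle does not repeat the start vertex at the end.
\<close>

definition cycle :: "'a set \<Rightarrow> 'a set set \<Rightarrow> 'a list \<Rightarrow> bool" where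
  "cycle V E c \<longleftrightarrow> walk V E c \<and> distinct c \<and> length c \<ge> 3 \<and> {last c, hd c} \<in> E"

definition tree :: "'a set \<Rightarrow> 'a set set \<Rightarrow> bool" where
  "tree V E \<longleftrightarrow> connected_graph V E \<and> (\<nexists>c. cycle V E c)"

definition spanning_trees :: "'a set \<Rightarrow> 'a set set \<Rightarrow> 'a set set set" where
  "spanning_trees V E = {T. T \<subseteq> E \<and> tree V T}"

definition num_spanning_trees :: "'a set \<Rightarrow> 'a set set \<Rightarrow> nat" where
  "num_spanning_trees V E = card (spanning_trees V E)"

text \<open>
  The residues modulo \<open>N\<close> are represented by the integers \<open>0, \<dots>, N - 1\<close>.
\<close>

definition circ_dist :: "nat \<Rightarrow> int \<Rightarrow> int \<Rightarrow> int" where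
  "circ_dist N x y = min \<bar>x - y\<bar> (int N - \<bar>x - y\<bar>)"

definition G2_verts :: "nat \<Rightarrow> int set" where
  "G2_verts N = {0..<int N}"

definition G2_edges :: "nat \<Rightarrow> int set set" where
  "G2_edges N =
     {{x, y} | x y. x \<in> G2_verts N \<and> y \<in> G2_verts N \<and> x \<noteq> y \<and> circ_dist N x y \<ge> 3}"

definition tau2 :: "nat \<Rightarrow> complex" where
  "tau2 N = (- 1 + \<i> * complex_of_real (sqrt (4 * real N - 25))) / 2"

definition rho2 :: "nat \<Rightarrow> complex" where
  "rho2 N = (THE \<rho>. \<rho> + inverse \<rho> = tau2 N \<and> cmod \<rho> < 1)"

definition P2 :: "nat \<Rightarrow> nat \<Rightarrow> complex" where
  "P2 N k = rho2 N ^ k + inverse (rho2 N) ^ k"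

text \<open>
  For \<open>N \<ge> 7\<close> the description of \<open>rho2\<close> determines a unique, nonzero number, so that neither
  \<open>THE\<close> nor the convention \<open>inverse 0 = 0\<close> interferes.
\<close>

lemma ex1_joukowski:
  fixes t :: complex
  assumes "Im t \<noteq> 0"
  shows "\<exists>!z. z + inverse z = t \<and> cmod z < 1"
proof -
  define s where "s = csqrt (t\<^sup>2 - 4)"
  define a where "a = (t + s) / 2"
  define b where "b = (t - s) / 2"
  have s2: "s\<^sup>2 = t\<^sup>2 - 4" by (simp add: s_def)
  have "a * b = (t\<^sup>2 - s\<^sup>2) / 4"
    by (simp add: a_def b_def power2_eq_square algebra_simps)
  then have ab: "a * b = 1" by (simp add: s2)
  then have inv: "inverse a = b" "inverse b = a"
    by (simp_all add: inverse_unique mult.commute)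
  have sum: "a + b = t" by (simp add: a_def b_def field_simps)
  have "cmod a \<noteq> 1"
  proof
    assume n: "cmod a = 1"
    then have "inverse a = cnj a" by (simp add: complex_eq_iff cmod_def)
    then have "Im t = 0" using sum inv by auto
    with assms show False by simp
  qed
  moreover have "cmod a * cmod b = 1" using ab by (metis norm_mult norm_one)
  ultimately have "cmod a < 1 \<or> cmod b < 1"
    by (smt (verit) mult_le_cancel_left1 norm_ge_zero)
  then have ex: "\<exists>z. z + inverse z = t \<and> cmod z < 1"
    using sum inv by (metis add.commute)
  have "z = w" if z: "z + inverse z = t" "cmod z < 1" and w: "w + inverse w = t" "cmod w < 1"
    for z w
  proof -
    have nz: "z \<noteq> 0" "w \<noteq> 0" using z w assms by auto
    have "(z - w) * (z * w - 1) = ((z + inverse z) - (w + inverse w)) * (z * w)"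
      using nz by (simp add: field_simps)
    then have "(z - w) * (z * w - 1) = 0" using z w by simp
    moreover have "cmod (z * w) < 1"
      using z w mult_strict_mono'[of "cmod z" 1 "cmod w" 1] by (simp add: norm_mult)
    then have "z * w \<noteq> 1" by auto
    ultimately show "z = w" by simp
  qed
  with ex show ?thesis by blast
qed

lemma rho2:
  assumes "N \<ge> 7"
  shows "rho2 N + inverse (rho2 N) = tau2 N" "cmod (rho2 N) < 1" "rho2 N \<noteq> 0"
proof -
  have im: "Im (tau2 N) \<noteq> 0" using assms by (simp add: tau2_def)
  have *: "rho2 N + inverse (rho2 N) = tau2 N \<and> cmod (rho2 N) < 1"
    unfolding rho2_def by (rule theI'[OF ex1_joukowski[OF im]])
  then show "rho2 N + inverse (rho2 N) = tau2 N" "cmod (rho2 N) < 1" by auto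
  show "rho2 N \<noteq> 0" using * im by auto
qed

end

theory Submission
  imports Defs "Jordan_Normal_Form.Determinant"
begin

text \<open>
  Orienting a spanning tree towards a root \<open>r\<close> identifies it with its parent function, that is, with
  a choice of a neighbour at every vertex other than \<open>r\<close> whose iterates all lead to \<open>r\<close>.
  Expanding the determinant of the reduced Laplacian by rows gives a sum over all choices of
  neighbours, in which the parent functions contribute 1 and all other choices 0. This is the
  matrix-tree theorem; in the form \<open>det (L + J) = n\<^sup>2 t(G)\<close>, with \<open>J\<close> the all-ones matrix, no row
  has to be deleted, and for \<open>G = G_N^(2)\<close> the matrix \<open>L + J\<close> is circulant. Its eigenvalue
  at \<open>z\<close> with \<open>z\<^sup>N = 1\<close> is \<open>x\<^sup>2 + x + N - 6 = \<bar>\<tau> - x\<bar>\<^sup>2\<close> for \<open>x = z + 1/z\<close>, and with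
  \<open>\<tau> = \<rho> + 1/\<rho>\<close> the product of \<open>\<tau> - x = (\<rho> - z)(\<rho> - 1/z)/\<rho>\<close> over all \<open>z\<close> is
  \<open>(\<rho>\<^sup>N - 1)\<^sup>2/\<rho>\<^sup>N = P_N - 2\<close>.
\<close>

section \<open>Spanning trees and parent functions\<close>

definition simple_graph :: "'a set \<Rightarrow> 'a set set \<Rightarrow> bool" where
  "simple_graph V E \<longleftrightarrow> E \<subseteq> {{x, y} | x y. x \<in> V \<and> y \<in> V \<and> x \<noteq> y}"

lemma simple_graph_edgeD:
  assumes "simple_graph V E" and "{x, y} \<in> E"
  shows "x \<in> V" "y \<in> V" "x \<noteq> y"
proof -
  obtain a b where "{x, y} = {a, b}" "a \<in> V" "b \<in> V" "a \<noteq> b"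
    using assms unfolding simple_graph_def by blast
  then show "x \<in> V" "y \<in> V" "x \<noteq> y" by (auto simp: doubleton_eq_iff)
qed

lemma simple_graph_mono: "simple_graph V E \<Longrightarrow> T \<subseteq> E \<Longrightarrow> simple_graph V T"
  by (auto simp: simple_graph_def)

lemma walk_append:
  assumes "walk V E p" "walk V E q" "last p = hd q"
  shows "walk V E (p @ tl q)" "hd (p @ tl q) = hd p" "last (p @ tl q) = last q"
proof -
  obtain y q' where q: "q = y # q'" using assms by (cases q) (auto simp: walk_def)
  have p: "p \<noteq> []" using assms by (auto simp: walk_def)
  show "hd (p @ tl q) = hd p" "last (p @ tl q) = last q" using p assms(3) q by auto
  show "walk V E (p @ tl q)"
    using assms q p
    by (cases q') (auto simp: walk_def successively_append_iff)
qed

lemma walk_rev: "walk V E p \<Longrightarrow> walk V E (rev p)"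
  by (simp add: walk_def successively_rev insert_commute)

lemma walk_mono: "walk V T p \<Longrightarrow> T \<subseteq> E \<Longrightarrow> walk V E p"
  unfolding walk_def by (blast intro: successively_mono)

lemma connected_graphI:
  assumes "r \<in> V" and "\<And>v. v \<in> V \<Longrightarrow> \<exists>p. walk V E p \<and> hd p = v \<and> last p = r"
  shows "connected_graph V E"
proof -
  have "\<exists>p. walk V E p \<and> hd p = u \<and> last p = v" if uv: "u \<in> V" "v \<in> V" for u v
  proof -
    obtain p q where p: "walk V E p" "hd p = u" "last p = r"
      and q: "walk V E q" "hd q = v" "last q = r"
      using assms(2)[OF uv(1)] assms(2)[OF uv(2)] by blast
    have "q \<noteq> []" using q by (auto simp: walk_def)
    then show ?thesis
      using walk_append[OF p(1) walk_rev[OF q(1)]] p q by (metis hd_rev last_rev)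
  qed
  then show ?thesis using assms(1) by (auto simp: connected_graph_def)
qed

lemma walk_distinct:
  assumes "walk V E p"
  obtains q where "walk V E q" "distinct q" "hd q = hd p" "last q = last p"
  using assms
proof (induction p arbitrary: thesis rule: length_induct)
  case (1 p)
  show ?case
  proof (cases "distinct p")
    case False
    \<comment> \<open>Cutting out the loop between two visits to \<open>y\<close> leaves a shorter
      walk with the same ends.\<close>
    then obtain xs ys zs y where p: "p = xs @ [y] @ ys @ [y] @ zs"
      using not_distinct_decomp by blast
    let ?q = "xs @ [y] @ zs"
    have "length ?q < length p" using p by simp
    moreover have "walk V E ?q"
      using 1(3) unfolding p walk_def
      by (auto simp: successively_append_iff successively_Cons)
    moreover have "hd ?q = hd p" "last ?q = last p"
      unfolding p by (cases xs; simp) (cases zs; simp)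
    ultimately show ?thesis using 1(1) 1(2) by metis
  qed (use 1 in blast)
qed

text \<open>The two neighbours are the successor and the predecessor of \<open>x\<close> in cyclic
  order; they differ because a cycle has at least three vertices.\<close>

lemma cycle_two_neighbours:
  assumes "cycle V E c" and "x \<in> set c"
  obtains y z where "y \<in> set c" "z \<in> set c" "y \<noteq> z" "{x, y} \<in> E" "{x, z} \<in> E"
proof -
  define m where "m = length c"
  have c: "c \<noteq> []" "distinct c" "m \<ge> 3" "{last c, hd c} \<in> E"
    and step: "\<And>i. Suc i < m \<Longrightarrow> {c ! i, c ! Suc i} \<in> E"
    using assms(1) by (auto simp: cycle_def walk_def m_def successively_conv_nth)
  obtain i where i: "i < m" "c ! i = x" using assms(2) by (auto simp: in_set_conv_nth m_def)
  define s where "s = (if Suc i < m then Suc i else 0)"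
  define t where "t = (if i = 0 then m - 1 else i - 1)"
  \<comment> \<open>The closing edge serves as successor edge of the last vertex and as predecessor
    edge of the first.\<close>
  have wrap: "{c ! (m - 1), c ! 0} \<in> E"
    using c by (simp add: m_def last_conv_nth hd_conv_nth)
  have "{x, c ! s} \<in> E"
  proof (cases "Suc i < m")
    case False
    then have "i = m - 1" using i by simp
    then show ?thesis using wrap i False by (simp add: s_def)
  qed (use step i in \<open>auto simp: s_def\<close>)
  moreover have "{x, c ! t} \<in> E"
  proof (cases "i = 0")
    case False
    then show ?thesis using step[of "i - 1"] i by (simp add: t_def insert_commute)
  qed (use wrap i in \<open>auto simp: t_def insert_commute\<close>)
  moreover have "s < m" "t < m" "s \<noteq> t" using c(3) i by (auto simp: s_def t_def)
  then have "c ! s \<noteq> c ! t" "c ! s \<in> set c" "c ! t \<in> set c"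
    using c(2) by (auto simp: m_def nth_eq_iff_index_eq)
  ultimately show thesis using that by blast
qed

text \<open>An edge of \<open>T\<close> missing from \<open>T'\<close> would close a path of
  \<open>T'\<close> between its ends to a cycle in \<open>T\<close>.\<close>

lemma connected_subgraph_of_tree:
  assumes "simple_graph V T" "tree V T" and "connected_graph V T'" "T' \<subseteq> T"
  shows "T' = T"
proof (rule ccontr)
  assume "T' \<noteq> T"
  then obtain e where e: "e \<in> T" "e \<notin> T'" using assms(4) by blast
  then obtain x y where xy: "e = {x, y}" "x \<in> V" "y \<in> V" "x \<noteq> y"
    using assms(1) unfolding simple_graph_def by blast
  then obtain p where "walk V T' p" "hd p = x" "last p = y"
    using assms(3) unfolding connected_graph_def by blast
  then obtain q where q: "walk V T' q" "distinct q" "hd q = x" "last q = y"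
    using walk_distinct by metis
  \<comment> \<open>A path with one vertex would give \<open>x = y\<close>, and one with two
    vertices would put \<open>e\<close> itself into \<open>T'\<close>.\<close>
  have "length q \<ge> 3"
  proof (rule ccontr)
    assume "\<not> length q \<ge> 3"
    then have "length q = 0 \<or> length q = 1 \<or> length q = 2" by linarith
    then show False
      using q xy e by (auto simp: walk_def length_Suc_conv numeral_2_eq_2)
  qed
  moreover have "{last q, hd q} \<in> T" using q xy e by (simp add: insert_commute)
  ultimately have "cycle V T q"
    using q walk_mono[OF q(1) assms(4)] by (simp add: cycle_def)
  then show False using assms(2) by (auto simp: tree_def)
qed

section \<open>Rooted spanning trees as parent functions\<close>

text \<open>Being the identity at \<open>r\<close> and outside \<open>V\<close> makes such a
  function determined by the parents alone, so that counting functions counts trees. It also matches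
  the index set of the row expansion of a determinant.\<close>

definition parent_functions :: "'a set \<Rightarrow> 'a set set \<Rightarrow> 'a \<Rightarrow> ('a \<Rightarrow> 'a) set" where
  "parent_functions V E r =
     {f. (\<forall>v\<in>V - {r}. {v, f v} \<in> E) \<and> (\<forall>v. v \<notin> V - {r} \<longrightarrow> f v = v) \<and>
         (\<forall>v\<in>V. \<exists>k. (f ^^ k) v = r)}"

definition parent_edges :: "'a set \<Rightarrow> 'a \<Rightarrow> ('a \<Rightarrow> 'a) \<Rightarrow> 'a set set" where
  "parent_edges V r f = (\<lambda>v. {v, f v}) ` (V - {r})"

definition depth :: "('a \<Rightarrow> 'a) \<Rightarrow> 'a \<Rightarrow> 'a \<Rightarrow> nat" where
  "depth f r v = (LEAST k. (f ^^ k) v = r)"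

lemma depth_parent:
  assumes "(f ^^ k) v = r" and "v \<noteq> r"
  shows "depth f r v = Suc (depth f r (f v))"
  using Least_Suc[of "\<lambda>k. (f ^^ k) v = r" k] assms
  by (simp add: depth_def funpow_swap1)

lemma parent_edges_eqD:
  assumes "{x, y} \<in> parent_edges V r f"
  shows "(x \<in> V - {r} \<and> y = f x) \<or> (y \<in> V - {r} \<and> x = f y)"
  using assms by (auto simp: parent_edges_def doubleton_eq_iff)

text \<open>Following parents connects every vertex to \<open>r\<close>. On a cycle, a vertex
  \<open>x\<close> of greatest depth would have two distinct neighbours; but an edge of the tree
  joins a vertex to its parent, which is less deep, so each neighbour of \<open>x\<close> on the
  cycle must be \<open>f x\<close>.\<close>

lemma tree_parent_edges:
  assumes E: "simple_graph V E" and r: "r \<in> V" and f: "f \<in> parent_functions V E r"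
  shows "tree V (parent_edges V r f)"
proof -
  let ?T = "parent_edges V r f"
  have fE: "\<And>v. v \<in> V - {r} \<Longrightarrow> {v, f v} \<in> E"
    and reach: "\<And>v. v \<in> V \<Longrightarrow> \<exists>k. (f ^^ k) v = r"
    using f by (auto simp: parent_functions_def)
  have dp: "depth f r v = Suc (depth f r (f v))" if "v \<in> V - {r}" for v
    using that reach depth_parent by (metis DiffE insertI1)
  have "\<exists>p. walk V ?T p \<and> hd p = v \<and> last p = r" if "v \<in> V" for v
    using that
  proof (induction "depth f r v" arbitrary: v rule: less_induct)
    case less
    show ?case
    proof (cases "v = r")
      case True
      then show ?thesis using r by (intro exI[of _ "[r]"]) (simp add: walk_def)
    next
      case False
      then have v: "v \<in> V - {r}" using less by simp
      have "f v \<in> V" using simple_graph_edgeD[OF E fE[OF v]] by simp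
      then obtain p where p: "walk V ?T p" "hd p = f v" "last p = r"
        using less(1) dp[OF v] by (metis lessI)
      then have "walk V ?T (v # p)"
        using v by (auto simp: walk_def successively_Cons parent_edges_def)
      then show ?thesis using p by (intro exI[of _ "v # p"]) (auto simp: walk_def)
    qed
  qed
  then have "connected_graph V ?T" by (rule connected_graphI[OF r])
  moreover have False if c: "cycle V ?T c" for c
  proof -
    have "set c \<noteq> {}" using c by (auto simp: cycle_def walk_def)
    then have "Max (depth f r ` set c) \<in> depth f r ` set c" by (intro Max_in) auto
    then obtain x where "x \<in> set c" "depth f r x = Max (depth f r ` set c)" by auto
    then have x: "x \<in> set c" "\<And>y. y \<in> set c \<Longrightarrow> depth f r y \<le> depth f r x" by simp_all
    obtain y z where yz: "y \<in> set c" "z \<in> set c" "y \<noteq> z" "{x, y} \<in> ?T" "{x, z} \<in> ?T"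
      using cycle_two_neighbours[OF c x(1)] by blast
    have "w = f x" if "w \<in> set c" "{x, w} \<in> ?T" for w
      using parent_edges_eqD[OF that(2)] dp[of w] x(2)[OF that(1)] by auto
    then show False using yz by blast
  qed
  ultimately show ?thesis by (auto simp: tree_def)
qed

text \<open>The edge set determines the orientation, by induction on depth. If the edge from
  \<open>v\<close> to \<open>f v\<close> were directed the other way by \<open>g\<close>, the
  induction hypothesis at \<open>f v\<close> would give \<open>f (f v) = g (f v) = v\<close>,
  although depth falls along \<open>f\<close>.\<close>

lemma inj_on_parent_edges: "inj_on (parent_edges V r) (parent_functions V E r)"
proof (rule inj_onI)
  fix f g
  assume f: "f \<in> parent_functions V E r" and g: "g \<in> parent_functions V E r"
    and eq: "parent_edges V r f = parent_edges V r g"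
  have reach: "\<And>v. v \<in> V \<Longrightarrow> \<exists>k. (f ^^ k) v = r"
    using f by (auto simp: parent_functions_def)
  have dp: "depth f r v = Suc (depth f r (f v))" if "v \<in> V - {r}" for v
    using that reach depth_parent by (metis DiffE insertI1)
  have "f v = g v" if "v \<in> V - {r}" for v
    using that
  proof (induction "depth f r v" arbitrary: v rule: less_induct)
    case less
    have "{v, f v} \<in> parent_edges V r g"
      using less(2) eq by (auto simp: parent_edges_def)
    then consider "f v = g v" | "f v \<in> V - {r}" "v = g (f v)"
      using parent_edges_eqD by metis
    then show ?case
    proof cases
      case 2
      have "f (f v) = g (f v)" using less(1)[of "f v"] dp[OF less(2)] 2 by simp
      then have "f (f v) = v" using 2 by simp
      then show ?thesis using dp[OF less(2)] dp[OF 2(1)] by simp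
    qed
  qed
  moreover have "f v = g v" if "v \<notin> V - {r}" for v
    using f g that by (simp add: parent_functions_def)
  ultimately show "f = g" by blast
qed

text \<open>Each vertex gets as parent a neighbour closer to \<open>r\<close>. The resulting edges
  already form a connected subgraph of \<open>T\<close>, hence are all of \<open>T\<close>.\<close>

lemma tree_imp_parent_edges:
  assumes T: "simple_graph V T" "tree V T" and r: "r \<in> V"
  obtains f where "f \<in> parent_functions V T r" "parent_edges V r f = T"
proof -
  \<comment> \<open>Walks are measured by their number of vertices, so for \<open>v\<close> in
    \<open>V\<close> the value \<open>d v\<close> is the distance to \<open>r\<close> plus
    one.\<close>
  define len where "len v n \<longleftrightarrow> (\<exists>p. walk V T p \<and> hd p = v \<and> last p = r \<and> length p = n)" for v n
  define d where "d v = (LEAST n. len v n)" for v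
  have d: "len v (d v)" if v: "v \<in> V" for v
  proof -
    have "\<exists>n. len v n"
      using T(2) r v unfolding tree_def connected_graph_def len_def by blast
    then show ?thesis unfolding d_def by (rule LeastI_ex)
  qed
  have "\<exists>w. {v, w} \<in> T \<and> d w < d v" if v: "v \<in> V - {r}" for v
  proof -
    obtain p where p: "walk V T p" "hd p = v" "last p = r" "length p = d v"
      using d[of v] v unfolding len_def by auto
    \<comment> \<open>The second vertex of a shortest walk from \<open>v\<close> to \<open>r\<close>
      is the neighbour sought.\<close>
    then obtain w q where pq: "p = v # w # q"
      using v by (cases p; cases "tl p") (auto simp: walk_def)
    then have "len w (length (w # q))" using p unfolding len_def
      by (intro exI[of _ "w # q"]) (auto simp: walk_def)
    then have "d w \<le> length (w # q)" unfolding d_def by (rule Least_le)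
    then show ?thesis using p pq by (auto simp: walk_def)
  qed
  then obtain g where g: "\<And>v. v \<in> V - {r} \<Longrightarrow> {v, g v} \<in> T \<and> d (g v) < d v" by metis
  define f where "f v = (if v \<in> V - {r} then g v else v)" for v
  have "\<exists>k. (f ^^ k) v = r" if "v \<in> V" for v
    using that
  proof (induction "d v" arbitrary: v rule: less_induct)
    case less
    show ?case
    proof (cases "v = r")
      case True
      then show ?thesis by (intro exI[of _ 0]) simp
    next
      case False
      then have v: "v \<in> V - {r}" using less by simp
      then have "{v, f v} \<in> T" "d (f v) < d v" using g[OF v] by (simp_all add: f_def)
      then obtain k where "(f ^^ k) (f v) = r"
        using less(1) simple_graph_edgeD[OF T(1)] by metis
      then have "(f ^^ Suc k) v = r" by (simp add: funpow_swap1)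
      then show ?thesis by blast
    qed
  qed
  then have f: "f \<in> parent_functions V T r"
    using g by (auto simp: parent_functions_def f_def)
  moreover have "parent_edges V r f \<subseteq> T" using g by (auto simp: parent_edges_def f_def)
  then have "parent_edges V r f = T"
    using connected_subgraph_of_tree[OF T] tree_parent_edges[OF T(1) r f] by (auto simp: tree_def)
  ultimately show thesis using that by blast
qed

theorem num_spanning_trees_eq_card_parent_functions:
  assumes E: "simple_graph V E" and r: "r \<in> V"
  shows "num_spanning_trees V E = card (parent_functions V E r)"
proof -
  have "parent_edges V r ` parent_functions V E r = spanning_trees V E"
  proof (intro equalityI subsetI)
    fix T assume "T \<in> parent_edges V r ` parent_functions V E r"
    then show "T \<in> spanning_trees V E"
      using tree_parent_edges[OF E r]
      by (auto simp: spanning_trees_def parent_edges_def parent_functions_def)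
  next
    fix T assume T: "T \<in> spanning_trees V E"
    then have TE: "T \<subseteq> E" "tree V T" by (auto simp: spanning_trees_def)
    obtain f where f: "f \<in> parent_functions V T r" "parent_edges V r f = T"
      using tree_imp_parent_edges[OF simple_graph_mono[OF E TE(1)] TE(2) r] .
    have "f \<in> parent_functions V E r" using f(1) TE(1) by (auto simp: parent_functions_def)
    then show "T \<in> parent_edges V r ` parent_functions V E r" using f(2) by blast
  qed
  then show ?thesis
    unfolding num_spanning_trees_def using card_image[OF inj_on_parent_edges] by metis
qed

section \<open>Relabelling the vertices\<close>

text \<open>Needed because matrices are indexed by natural numbers while the graph lives on
  integers. Walks are pushed forward along \<open>h\<close>; a cycle in the image is pulled back to
  a cycle in the original graph.\<close>

lemma tree_image:
  assumes h: "inj_on h V" and E: "simple_graph V E" and T: "tree V E"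
  shows "tree (h ` V) ((`) h ` E)"
proof -
  have walk: "walk (h ` V) ((`) h ` E) (map h p)" if "walk V E p" for p
    using that unfolding walk_def successively_map
    by (auto elim!: successively_mono intro: image_eqI[of _ _ "{_, _}"])
  have "connected_graph (h ` V) ((`) h ` E)"
    unfolding connected_graph_def
  proof (intro conjI ballI)
    show "h ` V \<noteq> {}" using T by (simp add: tree_def connected_graph_def)
    fix u v assume "u \<in> h ` V" "v \<in> h ` V"
    then obtain a b where ab: "a \<in> V" "b \<in> V" "u = h a" "v = h b" by blast
    then obtain p where p: "walk V E p" "hd p = a" "last p = b"
      using T unfolding tree_def connected_graph_def by blast
    then have "p \<noteq> []" by (simp add: walk_def)
    then show "\<exists>p. walk (h ` V) ((`) h ` E) p \<and> hd p = u \<and> last p = v"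
      using walk[OF p(1)] p ab by (intro exI[of _ "map h p"]) (simp add: hd_map last_map)
  qed
  moreover have False if c: "cycle (h ` V) ((`) h ` E) c" for c
  proof -
    have edge: "{x, y} \<in> E" if xy: "x \<in> V" "y \<in> V" "{h x, h y} \<in> (`) h ` E" for x y
    proof -
      obtain e where "e \<in> E" "{h x, h y} = h ` e" using xy(3) by (rule imageE)
      then have e: "e \<in> E" "h ` e = h ` {x, y}" by simp_all
      then have "e \<subseteq> V" using E by (auto simp: simple_graph_def)
      then have "e = {x, y}" using inj_on_image_eq_iff[OF h, of e "{x, y}"] e xy by simp
      then show ?thesis using e by simp
    qed
    have "set c \<subseteq> h ` V" using c by (simp add: cycle_def walk_def)
    then have "c = map h (map (inv_into V h) c)" "set (map (inv_into V h) c) \<subseteq> V"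
      by (auto simp: f_inv_into_f inv_into_into subset_iff intro!: map_idI[symmetric])
    then obtain b where b: "c = map h b" "set b \<subseteq> V" by blast
    have ne: "b \<noteq> []" using c b by (auto simp: cycle_def)
    have "successively (\<lambda>x y. {x, y} \<in> E) b"
      using c b unfolding cycle_def walk_def
      by (auto simp: successively_map elim!: successively_mono intro!: edge)
    moreover have "{last b, hd b} \<in> E"
      using c b ne by (intro edge) (auto simp: cycle_def hd_map last_map)
    ultimately have "cycle V E b"
      using c b ne by (auto simp: cycle_def walk_def distinct_map)
    then show False using T by (auto simp: tree_def)
  qed
  ultimately show ?thesis by (auto simp: tree_def)
qed

lemma num_spanning_trees_image:
  assumes h: "inj_on h V" and E: "simple_graph V E"
  shows "num_spanning_trees (h ` V) ((`) h ` E) = num_spanning_trees V E"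
proof -
  have V: "T \<subseteq> Pow V" if "T \<subseteq> E" for T
    using simple_graph_mono[OF E that] by (auto simp: simple_graph_def)
  have "(`) ((`) h) ` spanning_trees V E = spanning_trees (h ` V) ((`) h ` E)"
  proof (intro equalityI subsetI)
    fix S assume "S \<in> (`) ((`) h) ` spanning_trees V E"
    then show "S \<in> spanning_trees (h ` V) ((`) h ` E)"
      using tree_image[OF h] simple_graph_mono[OF E] by (auto simp: spanning_trees_def)
  next
    fix S assume "S \<in> spanning_trees (h ` V) ((`) h ` E)"
    then obtain T where T: "T \<subseteq> E" "S = (`) h ` T" "tree (h ` V) S"
      by (auto simp: spanning_trees_def subset_image_iff)
    \<comment> \<open>Every spanning tree of the image arises: \<open>tree_image\<close> is applied
      to the inverse relabelling.\<close>
    let ?g = "inv_into V h"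
    have gh: "?g ` (h ` e) = e" if "e \<in> T" for e
      using V[OF T(1)] that h by (simp add: inv_into_image_cancel subset_iff)
    have "simple_graph (h ` V) S"
      unfolding simple_graph_def
    proof
      fix s assume "s \<in> S"
      then obtain x y where "s = h ` {x, y}" "x \<in> V" "y \<in> V" "x \<noteq> y"
        using T E unfolding simple_graph_def by blast
      then have "s = {h x, h y}" "h x \<in> h ` V" "h y \<in> h ` V" "h x \<noteq> h y"
        using h by (simp_all add: inj_on_eq_iff)
      then show "s \<in> {{x, y} | x y. x \<in> h ` V \<and> y \<in> h ` V \<and> x \<noteq> y}" by blast
    qed
    then have "tree (?g ` h ` V) ((`) ?g ` S)"
      using T(3) by (intro tree_image) (auto intro: inj_on_inv_into)
    moreover have "?g ` h ` V = V" using h by (simp add: inv_into_image_cancel)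
    moreover have "(`) ?g ` S = T" using gh T(2) by (force simp: image_image)
    ultimately show "S \<in> (`) ((`) h) ` spanning_trees V E"
      using T by (auto simp: spanning_trees_def)
  qed
  moreover have "inj_on ((`) ((`) h)) (spanning_trees V E)"
  proof (rule inj_on_subset)
    show "inj_on ((`) ((`) h)) (Pow (Pow V))" using h by (intro inj_on_image_Pow)
    show "spanning_trees V E \<subseteq> Pow (Pow V)" using V by (auto simp: spanning_trees_def)
  qed
  ultimately show ?thesis unfolding num_spanning_trees_def by (metis card_image)
qed

section \<open>The matrix-tree theorem\<close>

text \<open>The matrix is the identity minus the matrix of \<open>f\<close> with row and column
  \<open>r\<close> cleared. If all vertices reach \<open>r\<close>, ordering by depth makes it
  unitriangular in effect: only the identity permutation contributes, and no vertex other than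
  \<open>r\<close> is fixed by \<open>f\<close>. Otherwise the vertices that never reach
  \<open>r\<close> span a kernel vector.\<close>

lemma det_parent_matrix:
  fixes f :: "nat \<Rightarrow> nat"
  assumes r: "r < n" and fn: "\<And>i. i < n \<Longrightarrow> f i < n" and fr: "f r = r"
  shows "det (mat n n (\<lambda>(i, j). (if i = j then 1 else 0) -
            (if i \<noteq> r \<and> f i = j \<and> j \<noteq> r then 1 else 0 :: 'a :: idom))) =
         (if \<forall>v<n. \<exists>k. (f ^^ k) v = r then 1 else 0)"
    (is "det ?M = _")
proof (cases "\<forall>v<n. \<exists>k. (f ^^ k) v = r")
  case True
  have dp: "depth f r v = Suc (depth f r (f v))" if "v < n" "v \<noteq> r" for v
    using that True depth_parent by metis
  have "(\<Prod>i = 0..<n. ?M $$ (i, p i)) = (if p = id then 1 else 0)" if p: "p permutes {0..<n}" for p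
  proof (cases "p = id")
    case True
    have "f i \<noteq> i" if "i < n" "i \<noteq> r" for i using dp[OF that] by auto
    then have "?M $$ (i, p i) = 1" if "i < n" for i using True that by force
    then show ?thesis using True by simp
  next
    case False
    let ?S = "{v. v < n \<and> p v \<noteq> v}"
    \<comment> \<open>Take \<open>v\<close> deepest among the points moved by \<open>p\<close>. Its
      preimage \<open>u\<close> is moved too, and a nonzero entry at \<open>(u, v)\<close> would
      force \<open>f u = v\<close>, making \<open>u\<close> deeper than \<open>v\<close>.\<close>
    obtain v where v: "v \<in> ?S" "\<And>u. u \<in> ?S \<Longrightarrow> depth f r u \<le> depth f r v"
    proof -
      have "?S \<noteq> {}"
      proof
        assume "?S = {}"
        then have "p x = x" for x using permutes_not_in[OF p, of x] by (cases "x < n") auto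
        then show False using False by auto
      qed
      then have "Max (depth f r ` ?S) \<in> depth f r ` ?S" by (intro Max_in) auto
      then obtain v where "v \<in> ?S" "depth f r v = Max (depth f r ` ?S)" by auto
      then show thesis by (intro that[of v]) auto
    qed
    obtain u where u: "p u = v" "u < n"
      using permutes_surj[OF p] permutes_in_image[OF p] v(1)
      by (metis (mono_tags, lifting) atLeastLessThan_iff mem_Collect_eq surj_def zero_le)
    then have "u \<in> ?S" using v(1) by auto
    have "?M $$ (u, p u) = 0"
    proof (rule ccontr)
      assume "?M $$ (u, p u) \<noteq> 0"
      then have "u \<noteq> r" "f u = v" using u v(1) \<open>u \<in> ?S\<close> by (auto split: if_splits)
      then show False using dp[of u] u v(2)[OF \<open>u \<in> ?S\<close>] by simp
    qed
    then show ?thesis using u False by (auto intro!: prod_zero)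
  qed
  then have "det ?M = (\<Sum>p | p permutes {0..<n}. signof p * (if p = id then 1 else 0))"
    by (subst det_def'[of _ n]) (auto intro!: sum.cong)
  also have "\<dots> = (\<Sum>p | p permutes {0..<n}. if p = id then 1 else 0)"
    by (intro sum.cong) auto
  also have "\<dots> = 1"
    by (simp add: finite_permutations permutes_id)
  finally show ?thesis using True by simp
next
  case False
  define C where "C = {v. v < n \<and> (\<forall>k. (f ^^ k) v \<noteq> r)}"
  \<comment> \<open>Away from \<open>r\<close>, the set \<open>C\<close> is invariant under
    \<open>f\<close> in both directions; hence its indicator vector takes equal values at
    \<open>i\<close> and \<open>f i\<close> and is annihilated by every row.\<close>
  have fC: "f v \<in> C \<longleftrightarrow> v \<in> C" if "v < n" "v \<noteq> r" for v
  proof -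
    have "(\<forall>k. (f ^^ k) v \<noteq> r) \<longleftrightarrow> (\<forall>k. (f ^^ Suc k) v \<noteq> r)"
      using that by (metis funpow_0 not0_implies_Suc)
    then show ?thesis using that fn by (simp add: C_def funpow_swap1)
  qed
  have rC: "r \<notin> C" by (auto simp: C_def intro: exI[of _ 0])
  define x where "x = vec n (\<lambda>v. if v \<in> C then 1 else 0 :: 'a)"
  have x: "x \<in> carrier_vec n" by (simp add: x_def)
  have "x \<noteq> 0\<^sub>v n"
  proof
    assume "x = 0\<^sub>v n"
    moreover obtain v where "v < n" "v \<in> C" using False by (auto simp: C_def)
    ultimately have "(1 :: 'a) = 0" by (metis (full_types) index_vec index_zero_vec(1) x_def)
    then show False by simp
  qed
  moreover have "?M *\<^sub>v x = 0\<^sub>v n"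
  proof (rule eq_vecI)
    fix i assume "i < dim_vec (0\<^sub>v n :: 'a vec)"
    then have i: "i < n" by simp
    have "(?M *\<^sub>v x) $ i = (\<Sum>j = 0..<n. ((if i = j then 1 else 0) -
            (if i \<noteq> r \<and> f i = j \<and> j \<noteq> r then 1 else 0)) * (if j \<in> C then 1 else 0))"
      using i by (simp add: x_def scalar_prod_def)
    also have "\<dots> = (\<Sum>j = 0..<n. (if i = j then (if j \<in> C then 1 else 0) else 0) -
        (if f i = j then (if i \<noteq> r \<and> j \<in> C then 1 else 0) else 0))"
      using rC by (intro sum.cong) auto
    also have "\<dots> = 0"
      using i fn[OF i] fC[OF i] rC by (auto simp: sum_subtractf)
    finally show "(?M *\<^sub>v x) $ i = 0\<^sub>v n $ i" using i by simp
  qed simp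
  ultimately have "det ?M = 0"
    using x by (subst det_0_iff_vec_prod_zero[of _ n]) auto
  then show ?thesis using False by simp
qed

section \<open>Determinants built from the Laplacian\<close>

definition laplacian_entry :: "nat \<Rightarrow> nat set set \<Rightarrow> nat \<Rightarrow> nat \<Rightarrow> 'a :: comm_ring_1" where
  "laplacian_entry n E i j =
     (if i = j then of_nat (card {k. k < n \<and> {i, k} \<in> E}) else if {i, j} \<in> E then - 1 else 0)"

lemma simple_graph_no_loop: "simple_graph V E \<Longrightarrow> {i} \<notin> E"
  using simple_graph_edgeD(3)[of V E i i] by auto

text \<open>
  Expanding every row as a sum over the neighbours of its vertex leaves one determinant for each
  choice of a neighbour at every vertex other than the root.
\<close>

theorem reduced_matrix_tree:
  assumes E: "simple_graph {0..<n} E" and r: "r < n"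
  shows "det (mat n n (\<lambda>(i, j). if i = r \<or> j = r then (if i = j then 1 else 0)
                                 else laplacian_entry n E i j)) =
         (of_nat (num_spanning_trees {0..<n} E) :: 'a :: idom)"
    (is "det ?R = _")
proof -
  \<comment> \<open>\<open>good i k\<close> marks an admissible choice \<open>k\<close> at vertex
    \<open>i\<close>. The root has the single choice \<open>r\<close>, so its row is not split
    up.\<close>
  define good where "good i k \<longleftrightarrow> (if i = r then k = r else {i, k} \<in> E)" for i k
  \<comment> \<open>For an admissible choice, \<open>a i k\<close> is the unit vector at
    \<open>i\<close> minus the unit vector at \<open>k\<close>, the latter dropped if
    \<open>i\<close> or \<open>k\<close> is the root. Inadmissible choices give the zero vector, so
    the sum may run over all \<open>k\<close>.\<close>
  define a :: "nat \<Rightarrow> nat \<Rightarrow> 'a vec" where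
    "a i k = vec n (\<lambda>j. if good i k
       then (if i = j then 1 else 0) - (if i \<noteq> r \<and> k = j \<and> j \<noteq> r then 1 else 0) else 0)" for i k
  let ?F = "{f. (\<forall>i\<in>{0..<n}. f i \<in> {0..<n}) \<and> (\<forall>i. i \<notin> {0..<n} \<longrightarrow> f i = i)}"
  have "?R = mat\<^sub>r n n (\<lambda>i. finsum_vec TYPE('a) n (a i) {0..<n})"
  proof (rule eq_matI)
    fix i j
    assume "i < dim_row (mat\<^sub>r n n (\<lambda>i. finsum_vec TYPE('a) n (a i) {0..<n}))"
      and "j < dim_col (mat\<^sub>r n n (\<lambda>i. finsum_vec TYPE('a) n (a i) {0..<n}))"
    then have ij: "i < n" "j < n" by auto
    have "mat\<^sub>r n n (\<lambda>i. finsum_vec TYPE('a) n (a i) {0..<n}) $$ (i, j) = (\<Sum>k = 0..<n. a i k $ j)"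
      using ij by (simp add: index_finsum_vec a_def)
    also have "\<dots> = (\<Sum>k = 0..<n. (if good i k then (if i = j then 1 else 0) -
        (if i \<noteq> r \<and> k = j \<and> j \<noteq> r then 1 else 0) else 0))"
      using ij by (simp add: a_def)
    also have "\<dots> = ?R $$ (i, j)"
    proof -
      consider "i = r" | "i \<noteq> r" "i = j" | "i \<noteq> r" "i \<noteq> j" by blast
      then show ?thesis
      proof cases
        case 1
        then show ?thesis using ij by (auto simp: good_def)
      next
        case 2
        \<comment> \<open>On the diagonal each neighbour contributes 1, which gives the degree; off
          the diagonal only the choice \<open>k = j\<close> contributes.\<close>
        have "(\<Sum>k = 0..<n. (if good i k then (if i = j then 1 else 0) -
            (if i \<noteq> r \<and> k = j \<and> j \<noteq> r then 1 else 0) else 0)) =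
          (\<Sum>k = 0..<n. (if k \<in> {k. {i, k} \<in> E} then 1 else 0 :: 'a))"
          using 2 simple_graph_no_loop[OF E] by (intro sum.cong) (auto simp: good_def)
        also have "\<dots> = of_nat (card ({0..<n} \<inter> {k. {i, k} \<in> E}))"
          by (simp only: sum.If_cases[OF finite_atLeastLessThan]) simp
        also have "{0..<n} \<inter> {k. {i, k} \<in> E} = {k. k < n \<and> {i, k} \<in> E}" by auto
        finally show ?thesis using 2 ij by (simp add: laplacian_entry_def)
      next
        case 3
        have "(\<Sum>k = 0..<n. (if good i k then (if i = j then 1 else 0) -
            (if i \<noteq> r \<and> k = j \<and> j \<noteq> r then 1 else 0) else 0)) =
          (\<Sum>k = 0..<n. (if k = j then (if j \<noteq> r \<and> {i, j} \<in> E then - 1 else 0) else 0 :: 'a))"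
          using 3 by (intro sum.cong) (auto simp: good_def)
        then show ?thesis using 3 ij by (simp add: laplacian_entry_def)
      qed
    qed
    finally show "?R $$ (i, j) = mat\<^sub>r n n (\<lambda>i. finsum_vec TYPE('a) n (a i) {0..<n}) $$ (i, j)" ..
  qed auto
  then have "det ?R = (\<Sum>f\<in>?F. det (mat\<^sub>r n n (\<lambda>i. a i (f i))))"
    by (subst det_linear_rows_sum[symmetric]) (auto simp: a_def)
  also have "\<dots> = (\<Sum>f\<in>?F. if f \<in> parent_functions {0..<n} E r then 1 else 0)"
  proof (rule sum.cong)
    fix f assume f: "f \<in> ?F"
    show "det (mat\<^sub>r n n (\<lambda>i. a i (f i))) = (if f \<in> parent_functions {0..<n} E r then 1 else 0)"
    proof (cases "\<forall>i<n. good i (f i)")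
      case True
      then have fr: "f r = r" using r by (auto simp: good_def)
      have "mat\<^sub>r n n (\<lambda>i. a i (f i)) = mat n n (\<lambda>(i, j). (if i = j then 1 else 0) -
            (if i \<noteq> r \<and> f i = j \<and> j \<noteq> r then 1 else 0))"
        using True by (intro eq_matI) (auto simp: a_def)
      moreover have "f \<in> parent_functions {0..<n} E r \<longleftrightarrow> (\<forall>v<n. \<exists>k. (f ^^ k) v = r)"
        using True f fr by (auto simp: parent_functions_def good_def)
      ultimately show ?thesis using det_parent_matrix[OF r, of f] f fr by simp
    next
      case False
      then obtain i where i: "i < n" "\<not> good i (f i)" by blast
      \<comment> \<open>One inadmissible choice produces a zero row, so the whole determinant
        vanishes.\<close>
      have "mat\<^sub>r n n (\<lambda>i. a i (f i)) = mat\<^sub>r n n (\<lambda>k. if k = i then 0\<^sub>v n else a k (f k))"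
        using i by (intro eq_matI) (auto simp: a_def)
      then have "det (mat\<^sub>r n n (\<lambda>i. a i (f i))) = 0"
        using det_row_0[OF i(1), of "\<lambda>k. a k (f k)"] by (simp add: a_def)
      moreover have "f \<notin> parent_functions {0..<n} E r"
        using i r by (auto simp: parent_functions_def good_def split: if_splits)
      ultimately show ?thesis by simp
    qed
  qed simp
  also have "\<dots> = of_nat (card (?F \<inter> parent_functions {0..<n} E r))"
    using finite_bounded_functions[of "{0..<n}" "{0..<n}"] by (simp add: sum.If_cases)
  also have "?F \<inter> parent_functions {0..<n} E r = parent_functions {0..<n} E r"
  proof -
    have "f i < n" if "f \<in> parent_functions {0..<n} E r" "i < n" for f i
      using that simple_graph_edgeD(2)[OF E, of i "f i"]
      by (cases "i = r") (simp_all add: parent_functions_def)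
    moreover have "f i = i" if "f \<in> parent_functions {0..<n} E r" "\<not> i < n" for f i
      using that by (simp add: parent_functions_def)
    ultimately show ?thesis by (intro Int_absorb1 subsetI CollectI) simp
  qed
  finally show ?thesis
    using num_spanning_trees_eq_card_parent_functions[OF E] r by simp
qed

lemma laplacian_row_sum:
  assumes E: "simple_graph {0..<n} E" and i: "i < n"
  shows "(\<Sum>j = 0..<n. laplacian_entry n E i j) = (0 :: 'a :: comm_ring_1)"
proof -
  have "(\<Sum>j = 0..<n. laplacian_entry n E i j) =
      (\<Sum>j = 0..<n. (if i = j then of_nat (card {k. k < n \<and> {i, k} \<in> E}) else 0) -
        (if j \<in> {j. {i, j} \<in> E} then 1 else 0 :: 'a))"
    using simple_graph_no_loop[OF E] by (intro sum.cong) (auto simp: laplacian_entry_def)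
  also have "\<dots> = of_nat (card {k. k < n \<and> {i, k} \<in> E}) - of_nat (card ({0..<n} \<inter> {j. {i, j} \<in> E}))"
    using i by (simp only: sum_subtractf sum.If_cases[OF finite_atLeastLessThan]) simp
  also have "{0..<n} \<inter> {k. {i, k} \<in> E} = {k. k < n \<and> {i, k} \<in> E}" by auto
  finally show ?thesis by simp
qed

lemma laplacian_entry_sym: "laplacian_entry n E i j = laplacian_entry n E j i"
  by (simp add: laplacian_entry_def insert_commute)

text \<open>
  Replacing row and column 0 of the matrix by the row and column sums turns it into
  \<open>Z\<^sup>T R Z\<close>, where \<open>R\<close> is the reduced Laplacian and \<open>Z\<close> is triangular with determinant \<open>n\<close>.
\<close>

theorem matrix_tree:
  assumes E: "simple_graph {0..<n} E" and n: "n > 0"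
  shows "det (mat n n (\<lambda>(i, j). laplacian_entry n E i j + 1)) =
         (of_nat n)\<^sup>2 * (of_nat (num_spanning_trees {0..<n} E) :: 'a :: idom)"
    (is "det ?A = _")
proof -
  let ?L = "laplacian_entry n E :: nat \<Rightarrow> nat \<Rightarrow> 'a"
  define R where "R = mat n n (\<lambda>(i, j). if i = 0 \<or> j = 0 then (if i = j then 1 else 0) else ?L i j)"
  \<comment> \<open>Multiplication by \<open>U\<close> from the left replaces row 0 by the sum of
    all rows; \<open>transpose_mat U\<close> from the right does the same for columns.\<close>
  define U where "U = mat n n (\<lambda>(i, j). if i = 0 \<or> i = j then 1 else 0 :: 'a)"
  define Z where "Z = mat n n (\<lambda>(i, j). if i = 0 then (if j = 0 then of_nat n else 1)
                                          else if i = j then 1 else 0 :: 'a)"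
  have carr: "?A \<in> carrier_mat n n" "R \<in> carrier_mat n n" "U \<in> carrier_mat n n" "Z \<in> carrier_mat n n"
    by (simp_all add: R_def U_def Z_def)
  have row: "(\<Sum>j = 0..<n. ?L i j) = 0" if "i < n" for i by (rule laplacian_row_sum[OF E that])
  have col: "(\<Sum>i = 0..<n. ?L i j) = 0" if "j < n" for j
    using row[OF that] by (simp add: laplacian_entry_sym[of n E _ j])
  have pick: "(\<Sum>k = 0..<n. (if i = 0 \<or> i = k then 1 else 0) * g k) = (if i = 0 then sum g {0..<n} else g i)"
    if "i < n" for i and g :: "nat \<Rightarrow> 'a"
  proof (cases "i = 0")
    case False
    then have "(\<Sum>k = 0..<n. (if i = 0 \<or> i = k then 1 else 0) * g k) = (\<Sum>k = 0..<n. if i = k then g k else 0)"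
      by (intro sum.cong) auto
    then show ?thesis using False that by simp
  qed simp
  have UA: "U * ?A = mat n n (\<lambda>(i, j). if i = 0 then of_nat n else ?L i j + 1)"
  proof (rule eq_matI)
    fix i j assume "i < dim_row (mat n n (\<lambda>(i, j). if i = 0 then of_nat n else ?L i j + 1))"
      "j < dim_col (mat n n (\<lambda>(i, j). if i = 0 then of_nat n else ?L i j + 1))"
    then have ij: "i < n" "j < n" by auto
    have "(U * ?A) $$ (i, j) = (\<Sum>k = 0..<n. (if i = 0 \<or> i = k then 1 else 0) * (?L k j + 1))"
      using ij by (simp add: U_def scalar_prod_def)
    then show "(U * ?A) $$ (i, j) = mat n n (\<lambda>(i, j). if i = 0 then of_nat n else ?L i j + 1) $$ (i, j)"
      using ij by (simp add: pick sum.distrib col)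
  qed (auto simp: U_def)
  \<comment> \<open>Rows and columns of the Laplacian sum to 0, so only the all-ones matrix
    contributes to row and column 0.\<close>
  have UAU: "U * ?A * transpose_mat U = mat n n (\<lambda>(i, j). if i = 0 \<and> j = 0 then of_nat n * of_nat n
      else if i = 0 \<or> j = 0 then of_nat n else ?L i j + 1)" (is "_ = ?H")
  proof (rule eq_matI)
    fix i j assume "i < dim_row ?H" "j < dim_col ?H"
    then have ij: "i < n" "j < n" by auto
    have "(U * ?A * transpose_mat U) $$ (i, j) =
        (\<Sum>k = 0..<n. (if j = 0 \<or> j = k then 1 else 0) * (if i = 0 then of_nat n else ?L i k + 1))"
      unfolding UA using ij by (simp add: U_def scalar_prod_def mult.commute)
    then show "(U * ?A * transpose_mat U) $$ (i, j) = ?H $$ (i, j)"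
      using ij by (simp add: pick sum.distrib row)
  qed (auto simp: U_def)
  \<comment> \<open>Column \<open>i\<close> of \<open>Z\<close> is supported in rows 0 and
    \<open>i\<close>, so the products with \<open>Z\<close> and its transpose have at most two terms
    per entry.\<close>
  have sumR: "(\<Sum>k = 0..<n. (if k = 0 then a else if i = k then b else 0) * g k) =
      (if i = 0 then a * g 0 else a * g 0 + b * g i)" if "i < n" for i a b and g :: "nat \<Rightarrow> 'a"
  proof -
    have "(\<Sum>k = 0..<n. (if k = 0 then a else if i = k then b else 0) * g k) =
       (\<Sum>k = 0..<n. (if k = 0 then a * g 0 else 0) + (if i = k then (if i = 0 then 0 else b * g i) else 0))"
      by (intro sum.cong) auto
    then show ?thesis using that n by (simp add: sum.distrib)
  qed
  have RZ: "R * Z = mat n n (\<lambda>(i, j). if i = 0 then (if j = 0 then of_nat n else 1)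
      else if j = 0 then 0 else ?L i j)" (is "_ = ?K")
  proof (rule eq_matI)
    fix i j assume "i < dim_row ?K" "j < dim_col ?K"
    then have ij: "i < n" "j < n" by auto
    have "(R * Z) $$ (i, j) = (\<Sum>k = 0..<n. (if k = 0 then (if j = 0 then of_nat n else 1)
        else if j = k then 1 else 0) * (if i = 0 \<or> k = 0 then (if i = k then 1 else 0) else ?L i k))"
      using ij by (auto simp: R_def Z_def scalar_prod_def mult.commute intro!: sum.cong)
    then show "(R * Z) $$ (i, j) = ?K $$ (i, j)"
      using ij by (simp add: sumR)
  qed (auto simp: R_def Z_def)
  have "transpose_mat Z * (R * Z) = ?H"
  proof (rule eq_matI)
    fix i j assume "i < dim_row ?H" "j < dim_col ?H"
    then have ij: "i < n" "j < n" by auto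
    have "(transpose_mat Z * (R * Z)) $$ (i, j) = (\<Sum>k = 0..<n. (if k = 0 then (if i = 0 then of_nat n else 1)
        else if i = k then 1 else 0) * (if k = 0 then (if j = 0 then of_nat n else 1)
      else if j = 0 then 0 else ?L k j))"
      unfolding RZ using ij by (auto simp: Z_def scalar_prod_def intro!: sum.cong)
    then show "(transpose_mat Z * (R * Z)) $$ (i, j) = ?H $$ (i, j)"
      using ij by (simp add: sumR)
  qed (auto simp: R_def Z_def)
  with UAU have eq: "U * ?A * transpose_mat U = transpose_mat Z * (R * Z)" by simp
  have "det U = prod_list (diag_mat U)"
    by (rule det_upper_triangular[OF _ carr(3)]) (auto simp: U_def)
  then have detU: "det U = 1" by (simp add: prod_list_diag_prod U_def)
  have "det Z = prod_list (diag_mat Z)"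
    by (rule det_upper_triangular[OF _ carr(4)]) (auto simp: Z_def)
  also have "\<dots> = (\<Prod>i = 0..<n. if i = 0 then of_nat n else 1)"
    unfolding prod_list_diag_prod by (intro prod.cong) (auto simp: Z_def)
  finally have detZ: "det Z = of_nat n" using n by simp
  have "det ?A = det (U * ?A * transpose_mat U)"
    using carr by (simp add: det_mult[of _ n] det_transpose[of _ n] detU)
  also have "\<dots> = (of_nat n)\<^sup>2 * det R"
    unfolding eq using carr by (simp add: det_mult[of _ n] det_transpose[of _ n] detZ power2_eq_square)
  finally show ?thesis
    using reduced_matrix_tree[OF E n, where 'a = 'a] by (simp add: R_def)
qed

section \<open>Circulant determinants\<close>

text \<open>As polynomials in \<open>x\<close> both sides are monic of degree \<open>n\<close> and
  vanish at the same \<open>n\<close> points.\<close>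

lemma prod_minus_roots_unity:
  fixes x :: complex
  assumes "n > 0"
  shows "(\<Prod>z | z ^ n = 1. x - z) = x ^ n - 1"
proof -
  define p :: "complex poly" where "p = monom 1 n - 1"
  define q :: "complex poly" where "q = (\<Prod>z | z ^ n = 1. [:- z, 1:])"
  have fin: "finite {z :: complex. z ^ n = 1}" and card: "card {z :: complex. z ^ n = 1} = n"
    using assms by (auto intro: finite_roots_unity card_roots_unity_eq)
  have "q = p"
  proof (rule poly_eqI_degree_lead_coeff[where A = "{z. z ^ n = 1}" and n = n])
    have dq: "degree q = n" by (simp add: q_def degree_prod_sum_eq card)
    have "lead_coeff q = 1" unfolding q_def lead_coeff_prod by simp
    then show "coeff q n = coeff p n" using assms by (simp add: dq p_def)
    show "degree q \<le> n" using dq by simp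
    show "degree p \<le> n" unfolding p_def by (intro degree_diff_le) (auto simp: degree_monom_le)
    show "poly q z = poly p z" if "z \<in> {z. z ^ n = 1}" for z
      using that fin by (auto simp: q_def p_def poly_prod poly_monom)
  qed (use card in simp)
  then have "poly q x = poly p x" by simp
  then show ?thesis by (simp add: q_def p_def poly_prod poly_monom)
qed

text \<open>Each factor equals \<open>(r - z) * (r - inverse z) / r\<close>. Inversion permutes the
  roots of unity, so both linear factors multiply to \<open>r ^ n - 1\<close>.\<close>

lemma prod_joukowski_minus_roots_unity:
  fixes r :: complex
  assumes n: "n > 0" and r: "r \<noteq> 0"
  shows "(\<Prod>z | z ^ n = 1. r + inverse r - (z + inverse z)) = r ^ n + inverse r ^ n - 2"
proof -
  have nz: "z \<noteq> 0" if "z ^ n = 1" for z :: complex using that n by (auto simp: zero_power)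
  have inv: "(\<Prod>z | z ^ n = 1. r - inverse z) = (\<Prod>z | z ^ n = 1. r - z)"
    by (rule prod.reindex_bij_witness[of _ inverse inverse]) (auto simp: power_inverse)
  have "(\<Prod>z | z ^ n = 1. r + inverse r - (z + inverse z)) =
      (\<Prod>z | z ^ n = 1. inverse r * (r - z) * (r - inverse z))"
    using nz r by (intro prod.cong) (auto simp: field_simps)
  also have "\<dots> = inverse r ^ n * (r ^ n - 1) * (r ^ n - 1)"
    by (simp add: prod.distrib inv prod_minus_roots_unity[OF n] card_roots_unity_eq[OF n])
  also have "\<dots> = r ^ n + inverse r ^ n - 2"
    using r by (simp add: field_simps power_inverse)
  finally show ?thesis .
qed

section \<open>Diagonalising circulant matrices\<close>

text \<open>Allows a sum along row \<open>i\<close> of a circulant matrix to be reindexed by the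
  difference of the indices. Adding \<open>n\<close> first keeps the subtraction of naturals from
  truncating.\<close>

lemma bij_betw_shift_mod:
  assumes "i < n"
  shows "bij_betw (\<lambda>j. (j + n - i) mod n) {0..<n} {0..<n :: nat}"
proof (rule bij_betw_byWitness[where f' = "\<lambda>d. (d + i) mod n"])
  show "\<forall>j\<in>{0..<n}. ((j + n - i) mod n + i) mod n = j"
    using assms by (auto simp: mod_add_left_eq)
  show "\<forall>d\<in>{0..<n}. ((d + i) mod n + n - i) mod n = d"
  proof
    fix d assume "d \<in> {0..<n}"
    moreover have "((d + i) mod n + n - i) mod n = ((d + i) mod n + (n - i)) mod n"
      using assms by simp
    moreover have "\<dots> = (d + i + (n - i)) mod n" by (rule mod_add_left_eq)
    ultimately show "((d + i) mod n + n - i) mod n = d" using assms by simp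
  qed
qed (use assms in auto)

lemma power_mod_root_unity:
  fixes z :: "'a :: monoid_mult"
  assumes "z ^ n = 1"
  shows "z ^ (m mod n) = z ^ m"
proof -
  have "z ^ m = z ^ (n * (m div n) + m mod n)" by simp
  also have "\<dots> = z ^ (m mod n)" unfolding power_add power_mult by (simp add: assms)
  finally show ?thesis ..
qed

lemma root_unity_shift:
  fixes z :: "'a :: comm_monoid_mult"
  assumes "z ^ n = 1" "i < n" "j < n"
  shows "z ^ ((j + n - i) mod n) * z ^ i = z ^ j"
proof -
  have "z ^ ((j + n - i) mod n) * z ^ i = z ^ (j + n - i + i)"
    unfolding power_add by (simp add: power_mod_root_unity[OF assms(1)])
  also have "\<dots> = z ^ j" using assms by (simp add: power_add)
  finally show ?thesis .
qed

text \<open>The Fourier matrix diagonalises every circulant matrix.\<close>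

theorem det_circulant:
  fixes c :: "nat \<Rightarrow> complex"
  assumes n: "n > 0"
  shows "det (mat n n (\<lambda>(i, j). c ((j + n - i) mod n))) = (\<Prod>z | z ^ n = 1. \<Sum>d = 0..<n. c d * z ^ d)"
proof -
  define w :: "nat \<Rightarrow> complex" where "w k = cis (2 * pi * real k / real n)" for k
  have bij: "bij_betw w {0..<n} {z. z ^ n = 1}"
    using bij_betw_roots_unity[OF n] by (simp add: w_def[abs_def] lessThan_atLeast0)
  have wn: "w k ^ n = 1" for k
  proof -
    have "w k ^ n = cis (2 * pi * real k)"
      using n by (simp add: w_def DeMoivre)
    then show ?thesis by (simp only: cis_multiple_2pi Ints_of_nat)
  qed
  have w0: "w k \<noteq> 0" for k by (simp add: w_def)
  have wpow: "w i ^ k = w k ^ i" for i k by (simp add: w_def DeMoivre mult_ac)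
  define l where "l k = (\<Sum>d = 0..<n. c d * w k ^ d)" for k
  define A where "A = mat n n (\<lambda>(i, j). c ((j + n - i) mod n))"
  define F where "F = mat n n (\<lambda>(i, k). w k ^ i)"
  define G where "G = mat n n (\<lambda>(k, j). inverse (w j) ^ k)"
  define D where "D = mat n n (\<lambda>(i, j). if i = j then l i else 0)"
  have carr: "A \<in> carrier_mat n n" "F \<in> carrier_mat n n" "G \<in> carrier_mat n n" "D \<in> carrier_mat n n"
    by (simp_all add: A_def F_def G_def D_def)
  \<comment> \<open>Up to the factor \<open>n\<close>, \<open>G\<close> inverts the Fourier matrix
    \<open>F\<close>: off the diagonal the entries are geometric sums over a nontrivial root of
    unity. This is used only to see that \<open>det F\<close> is nonzero.\<close>
  have "F * G = of_nat n \<cdot>\<^sub>m 1\<^sub>m n"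
  proof (rule eq_matI)
    fix i j assume "i < dim_row (of_nat n \<cdot>\<^sub>m 1\<^sub>m n :: complex mat)"
      "j < dim_col (of_nat n \<cdot>\<^sub>m 1\<^sub>m n :: complex mat)"
    then have ij: "i < n" "j < n" by auto
    have "(F * G) $$ (i, j) = (\<Sum>k<n. (w i * inverse (w j)) ^ k)"
      using ij by (simp add: F_def G_def scalar_prod_def wpow[of _ i] power_mult_distrib lessThan_atLeast0)
    also have "\<dots> = (if i = j then of_nat n else 0)"
    proof (cases "i = j")
      case False
      then have "w i \<noteq> w j" using bij ij by (auto simp: bij_betw_def inj_on_def)
      then have "w i * inverse (w j) \<noteq> 1" using w0 by (simp add: field_simps)
      then have "(\<Sum>k<n. (w i * inverse (w j)) ^ k) =
          ((w i * inverse (w j)) ^ n - 1) / (w i * inverse (w j) - 1)"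
        by (rule geometric_sum)
      also have "(w i * inverse (w j)) ^ n = 1" by (simp add: power_mult_distrib power_inverse wn)
      finally show ?thesis using False by simp
    qed (simp add: w0)
    finally show "(F * G) $$ (i, j) = (of_nat n \<cdot>\<^sub>m 1\<^sub>m n) $$ (i, j)" using ij by simp
  qed (auto simp: F_def G_def)
  then have "det F * det G = of_nat n ^ n"
    using det_mult[OF carr(2,3)] by simp
  then have detF: "det F \<noteq> 0" using n by auto
  \<comment> \<open>Column \<open>k\<close> of \<open>F\<close> is an eigenvector of
    \<open>A\<close> with eigenvalue \<open>l k\<close>; \<open>det F\<close> then cancels.\<close>
  have "A * F = F * D"
  proof (rule eq_matI)
    fix i k assume "i < dim_row (F * D)" "k < dim_col (F * D)"
    then have ik: "i < n" "k < n" by (auto simp: F_def D_def)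
    have "(A * F) $$ (i, k) = (\<Sum>j = 0..<n. c ((j + n - i) mod n) * w k ^ j)"
      using ik by (simp add: A_def F_def scalar_prod_def)
    also have "\<dots> = (\<Sum>j = 0..<n. c ((j + n - i) mod n) * w k ^ ((j + n - i) mod n)) * w k ^ i"
      unfolding sum_distrib_right using ik root_unity_shift[OF wn]
      by (intro sum.cong) (auto simp: mult.assoc)
    also have "\<dots> = l k * w k ^ i"
      unfolding l_def by (simp only: sum.reindex_bij_betw[OF bij_betw_shift_mod[OF ik(1)],
          of "\<lambda>d. c d * w k ^ d"])
    also have "\<dots> = (\<Sum>m = 0..<n. if m = k then w k ^ i * l k else 0)" using ik by simp
    also have "\<dots> = (\<Sum>m = 0..<n. w m ^ i * (if m = k then l m else 0))"
      by (intro sum.cong) auto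
    also have "\<dots> = (F * D) $$ (i, k)" using ik by (simp add: F_def D_def scalar_prod_def)
    finally show "(A * F) $$ (i, k) = (F * D) $$ (i, k)" .
  qed (auto simp: A_def F_def D_def)
  then have "det A = det D"
    using detF det_mult[OF carr(1,2)] det_mult[OF carr(2,4)] by simp
  also have "\<dots> = prod_list (diag_mat D)"
    by (rule det_upper_triangular[OF _ carr(4)]) (auto simp: D_def)
  also have "\<dots> = (\<Prod>k = 0..<n. l k)" by (simp add: prod_list_diag_prod D_def)
  also have "\<dots> = (\<Prod>z | z ^ n = 1. \<Sum>d = 0..<n. c d * z ^ d)"
    unfolding l_def by (rule prod.reindex_bij_betw[OF bij])
  finally show ?thesis by (simp add: A_def)
qed

section \<open>The Laplacian of the graph\<close>

text \<open>A copy of the graph on natural numbers, to fit the index type of matrices.\<close>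

definition G2_nat_edges :: "nat \<Rightarrow> nat set set" where
  "G2_nat_edges N = {{x, y} | x y. x < N \<and> y < N \<and> x \<noteq> y \<and> circ_dist N (int x) (int y) \<ge> 3}"

lemma simple_graph_G2_nat: "simple_graph {0..<N} (G2_nat_edges N)"
  by (auto simp: simple_graph_def G2_nat_edges_def)

lemma G2_eq_image:
  "G2_verts N = int ` {0..<N}" "G2_edges N = (`) int ` G2_nat_edges N"
proof -
  show V: "G2_verts N = int ` {0..<N}" by (simp add: G2_verts_def image_int_atLeastLessThan)
  have "e \<in> (`) int ` G2_nat_edges N" if e: "e \<in> G2_edges N" for e
  proof -
    obtain u v where uv: "e = {u, v}" "u \<in> int ` {0..<N}" "v \<in> int ` {0..<N}" "u \<noteq> v"
        "circ_dist N u v \<ge> 3"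
      using e unfolding G2_edges_def V by blast
    then obtain x y where "u = int x" "v = int y" "x < N" "y < N" by auto
    then have "e = int ` {x, y}" "x < N" "y < N" "x \<noteq> y" "circ_dist N (int x) (int y) \<ge> 3"
      using uv by auto
    then show ?thesis unfolding G2_nat_edges_def by blast
  qed
  moreover have "e \<in> G2_edges N" if e: "e \<in> (`) int ` G2_nat_edges N" for e
  proof -
    obtain x y where "e = {int x, int y}" "x < N" "y < N" "x \<noteq> y" "circ_dist N (int x) (int y) \<ge> 3"
      using e unfolding G2_nat_edges_def by auto
    then show ?thesis unfolding G2_edges_def G2_verts_def by force
  qed
  ultimately show "G2_edges N = (`) int ` G2_nat_edges N" by blast
qed

lemma circ_dist_commute: "circ_dist N x y = circ_dist N y x"
  by (simp add: circ_dist_def abs_minus_commute)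

lemma G2_nat_edges_iff:
  assumes "x < N" "y < N"
  shows "{x, y} \<in> G2_nat_edges N \<longleftrightarrow> \<not> circ_dist N (int x) (int y) \<le> 2"
proof -
  have "x \<noteq> y" if "circ_dist N (int x) (int y) \<ge> 3" using that by (auto simp: circ_dist_def)
  then have "{x, y} \<in> G2_nat_edges N \<longleftrightarrow> circ_dist N (int x) (int y) \<ge> 3"
    using assms unfolding G2_nat_edges_def
    by (auto simp: doubleton_eq_iff circ_dist_commute[of N "int y"])
  then show ?thesis by linarith
qed

text \<open>The listed values represent the residues 0, 1, 2, -2 and -1, so nonadjacency depends on
  the difference of the vertices alone.\<close>

lemma circ_dist_le_2_iff:
  assumes "N \<ge> 5" "i < N" "j < N"
  shows "circ_dist N (int i) (int j) \<le> 2 \<longleftrightarrow> (j + N - i) mod N \<in> {0, 1, 2, N - 2, N - 1}"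
proof (cases "i \<le> j")
  case True
  then have "(j + N - i) mod N = j - i" using assms by (simp add: mod_if)
  then show ?thesis using True assms by (auto simp: circ_dist_def min_def)
next
  case False
  then have "(j + N - i) mod N = j + N - i" using assms by simp
  then show ?thesis using False assms by (auto simp: circ_dist_def min_def)
qed

lemma sum_nearby_residues:
  fixes g :: "nat \<Rightarrow> 'a :: comm_monoid_add"
  assumes "N \<ge> 5"
  shows "(\<Sum>d = 0..<N. if d \<in> {0, 1, 2, N - 2, N - 1} then g d else 0) =
         g 0 + g 1 + g 2 + g (N - 2) + g (N - 1)"
proof -
  have "(\<Sum>d = 0..<N. if d \<in> {0, 1, 2, N - 2, N - 1} then g d else 0) =
      sum g ({0..<N} \<inter> {0, 1, 2, N - 2, N - 1})"
    by (rule sum.inter_restrict[symmetric]) simp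
  also have "{0..<N} \<inter> {0, 1, 2, N - 2, N - 1} = {0, 1, 2, N - 2, N - 1}" using assms by auto
  \<comment> \<open>Writing \<open>N\<close> as \<open>m + 5\<close> makes it evident that the five
    residues are distinct.\<close>
  moreover obtain m where "N = m + 5" using assms by (metis add.commute le_Suc_ex)
  ultimately show ?thesis by (simp add: add_ac)
qed

text \<open>Adding 1 cancels the entry -1 of adjacent pairs and leaves 1 for distinct nearby pairs.
  A diagonal entry is the degree \<open>N - 5\<close> plus 1. So the matrix is circulant with a
  sparse first row.\<close>

lemma laplacian_G2:
  assumes N: "N \<ge> 5" and ij: "i < N" "j < N"
  shows "laplacian_entry N (G2_nat_edges N) i j + 1 =
    (let d = (j + N - i) mod N in (if d = 0 then of_nat N - 5 else 0) +
       (if d \<in> {0, 1, 2, N - 2, N - 1} then 1 else 0 :: complex))"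
proof (cases "i = j")
  case False
  then have "(j + N - i) mod N \<noteq> 0"
    using ij by (cases "i < j") (auto simp: mod_if)
  then show ?thesis
    using False circ_dist_le_2_iff[OF N ij] G2_nat_edges_iff[OF ij]
    by (simp add: laplacian_entry_def Let_def)
next
  case True
  let ?near = "{0, 1, 2, N - 2, N - 1}"
  \<comment> \<open>Shifting by \<open>i\<close> reduces the count of nearby vertices,
    \<open>i\<close> itself included, to the five residues.\<close>
  have "(\<Sum>k = 0..<N. if circ_dist N (int i) (int k) \<le> 2 then 1 else 0 :: nat) =
      (\<Sum>k = 0..<N. if (k + N - i) mod N \<in> ?near then 1 else 0)"
    using circ_dist_le_2_iff[OF N ij(1)] by (intro sum.cong) auto
  also have "\<dots> = (\<Sum>d = 0..<N. if d \<in> ?near then 1 else 0)"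
    by (rule sum.reindex_bij_betw[OF bij_betw_shift_mod[OF ij(1)]])
  also have "\<dots> = 5" by (subst sum_nearby_residues[OF N]) simp
  finally have near: "card ({0..<N} \<inter> {k. circ_dist N (int i) (int k) \<le> 2}) = 5"
    by (simp add: sum.If_cases)
  have "{k. k < N \<and> {i, k} \<in> G2_nat_edges N} =
      {0..<N} - ({0..<N} \<inter> {k. circ_dist N (int i) (int k) \<le> 2})"
    using G2_nat_edges_iff[OF ij(1)] by auto
  then have "card {k. k < N \<and> {i, k} \<in> G2_nat_edges N} = N - 5"
    using near by (simp add: card_Diff_subset)
  then show ?thesis using True ij N by (simp add: laplacian_entry_def of_nat_diff)
qed

text \<open>With \<open>x = z + inverse z\<close> the sum is \<open>x^2 + x + N - 6\<close>, whose
  roots are \<open>tau2 N\<close> and its conjugate. Since \<open>z\<close> lies on the unit circle,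
  \<open>x\<close> is real, so the two linear factors are conjugate.\<close>

lemma G2_eigenvalue:
  fixes z :: complex
  assumes N: "N \<ge> 7" and z: "z ^ N = 1"
  shows "(\<Sum>d = 0..<N. ((if d = 0 then of_nat N - 5 else 0) +
           (if d \<in> {0, 1, 2, N - 2, N - 1} then 1 else 0)) * z ^ d) =
         (tau2 N - (z + inverse z)) * cnj (tau2 N - (z + inverse z))"
proof -
  have z0: "z \<noteq> 0" using z N by (auto simp: zero_power)
  have "cmod z = 1" using z N power_eq_1_iff[OF z] by simp
  then have cz: "cnj z = inverse z" by (simp add: complex_eq_iff cmod_def)
  have zinv: "z ^ (N - 1) = inverse z" "z ^ (N - 2) = (inverse z)\<^sup>2"
    using z z0 N by (simp_all add: power_diff power_one_over inverse_eq_divide)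
  have t: "tau2 N + cnj (tau2 N) = - 1" "tau2 N * cnj (tau2 N) = of_nat N - 6"
  proof -
    show "tau2 N + cnj (tau2 N) = - 1" by (simp add: tau2_def complex_eq_iff)
    have "(sqrt (4 * real N - 25))\<^sup>2 = 4 * real N - 25" using N by simp
    then show "tau2 N * cnj (tau2 N) = of_nat N - 6"
      by (simp add: complex_mult_cnj tau2_def complex_eq_iff power2_eq_square field_simps)
  qed
  have "(\<Sum>d = 0..<N. ((if d = 0 then of_nat N - 5 else 0) +
           (if d \<in> {0, 1, 2, N - 2, N - 1} then 1 else 0)) * z ^ d) =
      (\<Sum>d = 0..<N. (if d = 0 then of_nat N - 5 else 0) +
           (if d \<in> {0, 1, 2, N - 2, N - 1} then z ^ d else 0))"
    by (intro sum.cong) auto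
  also have "\<dots> = of_nat N - 5 + (1 + z + z\<^sup>2 + (inverse z)\<^sup>2 + inverse z)"
    unfolding sum.distrib using N sum_nearby_residues[of N "\<lambda>d. z ^ d"] by (simp add: zinv zinv[unfolded One_nat_def])
  also have "\<dots> = (z + inverse z)\<^sup>2 + (z + inverse z) + (of_nat N - 6)"
    using z0 by (simp add: power2_sum)
  also have "\<dots> = (z + inverse z)\<^sup>2 - (tau2 N + cnj (tau2 N)) * (z + inverse z)
      + tau2 N * cnj (tau2 N)"
    by (simp only: t) simp
  also have "\<dots> = (tau2 N - (z + inverse z)) * cnj (tau2 N - (z + inverse z))"
    using cz by (simp add: algebra_simps power2_eq_square)
  finally show ?thesis .
qed

theorem theorem4p7:
  fixes N :: nat
  assumes "N \<ge> 7" and "odd N"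
  shows "real (num_spanning_trees (G2_verts N) (G2_edges N)) =
           (cmod (P2 N N - 2))\<^sup>2 / (real N)\<^sup>2"
proof -
  let ?t = "num_spanning_trees (G2_verts N) (G2_edges N)"
  define c :: "nat \<Rightarrow> complex" where
    "c d = (if d = 0 then of_nat N - 5 else 0) + (if d \<in> {0, 1, 2, N - 2, N - 1} then 1 else 0)" for d
  have N0: "N > 0" using assms by simp
  have P: "(\<Prod>z | z ^ N = 1. tau2 N - (z + inverse z)) = P2 N N - 2"
    using prod_joukowski_minus_roots_unity[OF N0 rho2(3)[OF assms(1)]]
    by (simp add: rho2(1)[OF assms(1)] P2_def)
  \<comment> \<open>The matrix-tree theorem is applied to the copy on natural numbers, which has as
    many spanning trees.\<close>
  have "(of_nat N)\<^sup>2 * of_nat ?t =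
      det (mat N N (\<lambda>(i, j). laplacian_entry N (G2_nat_edges N) i j + 1 :: complex))"
    unfolding matrix_tree[OF simple_graph_G2_nat N0] G2_eq_image
    by (simp add: num_spanning_trees_image simple_graph_G2_nat)
  also have "\<dots> = det (mat N N (\<lambda>(i, j). c ((j + N - i) mod N)))"
    using assms(1) by (intro arg_cong[of _ _ det] eq_matI) (simp_all add: laplacian_G2 c_def Let_def)
  also have "\<dots> = (\<Prod>z | z ^ N = 1. \<Sum>d = 0..<N. c d * z ^ d)"
    by (rule det_circulant[OF N0])
  also have "\<dots> = (\<Prod>z | z ^ N = 1. (tau2 N - (z + inverse z)) * cnj (tau2 N - (z + inverse z)))"
    unfolding c_def by (intro prod.cong refl G2_eigenvalue[OF assms(1)]) simp
  \<comment> \<open>Conjugation commutes with the product, so the second factors multiply to the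
    conjugate of \<open>P2 N N - 2\<close>.\<close>
  also have "\<dots> = (P2 N N - 2) * cnj (P2 N N - 2)"
    unfolding prod.distrib cnj_prod[symmetric] P ..
  also have "\<dots> = of_real ((cmod (P2 N N - 2))\<^sup>2)" by (rule complex_norm_square[symmetric])
  finally have "complex_of_real ((real N)\<^sup>2 * real ?t) = of_real ((cmod (P2 N N - 2))\<^sup>2)" by simp
  then have "(real N)\<^sup>2 * real ?t = (cmod (P2 N N - 2))\<^sup>2" by (simp only: of_real_eq_iff)
  then show ?thesis using N0 by (simp add: field_simps)
qed

end
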